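(* Let $\mathcal{H}$ be a real Hilbert space, $J\in\mathcal{C}$, and let $T^*(f)$ be the extinction time of the gradient flow of $J$ with initial datum $f$. Then $$T^*(f)\ge\|f\|_*,\qquad\text{where}\quad \|f\|_*:=\sup_{p\in\mathcal{N}(J)^\perp}\frac{\langle f,p\rangle}{J(p)}$$ denotes the dual norm of $f$ with respect to $J$.
   Context: The class $\mathcal{C}$ consists of all maps $J:\mathcal{H}\to\mathbb{R}\cup\{+\infty\}$ that are convex, lower semicontinuous with respect to the strong topology of $\mathcal{H}$, and absolutely one-homogeneous, i.e. $J(cu)=|c|J(u)$ for all $u\in\mathcal{H}$, $c\in\mathbb{R}\setminus\{0\}$, and $J(0)=0$. The subdifferential is $\partial J(u)=\{p\in\mathcal{H}:\langle p,v\rangle\le J(v)\ \forall v\in\mathcal{H},\ \langle p,u\rangle=J(u)\}$, and $\mathrm{dom}(\partial J)=\{u:\partial J(u)\ne\emptyset\}$. $\mathcal{N}(J)=\{u:J(u)=0\}$ is a closed linear space with orthogonal complement $\mathcal{N}(J)^\perp$, and $\bar f$ is the orthogonal projection of $f$ onto $\mathcal{N}(J)$. In the quotient defining $\|f\|_*$, the conventions are that it equals $0$ for $p=0$ and for $J(p)=+\infty$. The extinction time is $T^*(f):=\inf\{t>0:u(t)=\bar f\}$ (with $\inf\emptyset=+\infty$), where $u$ is the solution of the gradient flow: for $f\in\overline{\mathrm{dom}(\partial J)}$, the solution $(u,p)$ of $\partial_tu(t)=-p(t)$, $p(t)\in\partial J(u(t))$, $u(0)=f$ is the unique continuous $u:[0,\infty)\to\mathcal{H}$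 with $u(0)=f$ given by Brezis' theory (Lipschitz on $[\delta,\infty)$ for every $\delta>0$, $u(t)\in\mathrm{dom}(\partial J)$ for all $t>0$, right-differentiable at every $t>0$), together with $p(t):=-\partial_t^+u(t)$, which is the element of minimal norm in $\partial J(u(t))$ for every $t>0$. *)

theory Defs
  imports "HOL-Analysis.Analysis"
begin

definition ereal_convex :: "('a::real_vector \<Rightarrow> ereal) \<Rightarrow> bool" where
  "ereal_convex J \<longleftrightarrow>
     (\<forall>u v. \<forall>t\<in>{0<..<1::real}.
        J ((1 - t) *\<^sub>R u + t *\<^sub>R v) \<le> ereal (1 - t) * J u + ereal t * J v)"

definition lower_semicontinuous :: "('a::topological_space \<Rightarrow> ereal) \<Rightarrow> bool" where
  "lower_semicontinuous J \<longleftrightarrow> (\<forall>u. J u \<le> Liminf (at u) J)"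

definition abs_one_homogeneous :: "('a::real_vector \<Rightarrow> ereal) \<Rightarrow> bool" where
  "abs_one_homogeneous J \<longleftrightarrow>
     (\<forall>u. \<forall>c::real. c \<noteq> 0 \<longrightarrow> J (c *\<^sub>R u) = ereal \<bar>c\<bar> * J u) \<and> J 0 = 0"

text \<open>The class of functionals with values in the reals extended by plus infinity only.
  The topology of \<^typ>\<open>'a\<close> is the norm (strong) topology.\<close>

definition functional_class :: "('a::real_inner \<Rightarrow> ereal) set" where
  "functional_class = {J. (\<forall>u. J u \<noteq> -\<infinity>) \<and> ereal_convex J \<and>
     lower_semicontinuous J \<and> abs_one_homogeneous J}"

definition subdifferential :: "('a::real_inner \<Rightarrow> ereal) \<Rightarrow> 'a \<Rightarrow> 'a set" where
  "subdifferential J u = {p. (\<forall>v. ereal (p \<bullet> v) \<le> J v) \<and> ereal (p \<bullet> u) = J u}"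

definition dom_subdifferential :: "('a::real_inner \<Rightarrow> ereal) \<Rightarrow> 'a set" where
  "dom_subdifferential J = {u. subdifferential J u \<noteq> {}}"

definition null_space :: "('a::real_inner \<Rightarrow> ereal) \<Rightarrow> 'a set" where
  "null_space J = {u. J u = 0}"

text \<open>Well defined whenever \<open>S\<close> is a closed linear subspace of a Hilbert space.\<close>

definition orthogonal_projection :: "'a::real_inner set \<Rightarrow> 'a \<Rightarrow> 'a" where
  "orthogonal_projection S f = (THE g. g \<in> S \<and> f - g \<in> S\<^sup>\<bottom>)"

text \<open>The supremum is taken in \<^typ>\<open>ereal\<close>, so it may be infinite; the conditional
  implements the conventions for the quotient.\<close>

definition dual_norm :: "('a::real_inner \<Rightarrow> ereal) \<Rightarrow> 'a \<Rightarrow> ereal" where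
  "dual_norm J f = (SUP p \<in> (null_space J)\<^sup>\<bottom>.
     if p = 0 \<or> J p = \<infinity> then 0 else ereal (f \<bullet> p) / J p)"

text \<open>\<open>(u, p)\<close> is the solution of the gradient flow of \<open>J\<close> with initial datum \<open>f\<close>:
  \<open>u\<close> matters only on \<open>{0..}\<close> and \<open>p\<close> only on \<open>{0<..}\<close>, where
  \<open>p t\<close> is minus the right derivative of \<open>u\<close>.\<close>

definition gradient_flow ::
  "('a::real_inner \<Rightarrow> ereal) \<Rightarrow> 'a \<Rightarrow> (real \<Rightarrow> 'a) \<Rightarrow> (real \<Rightarrow> 'a) \<Rightarrow> bool" where
  "gradient_flow J f u p \<longleftrightarrow>
     continuous_on {0..} u \<and> u 0 = f \<and>
     (\<forall>\<delta>>0. \<exists>L. L-lipschitz_on {\<delta>..} u) \<and>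
     (\<forall>t>0. u t \<in> dom_subdifferential J \<and>
        (u has_vector_derivative - p t) (at_right t) \<and>
        is_arg_min norm (\<lambda>q. q \<in> subdifferential J (u t)) (p t))"

text \<open>\<open>u\<close> is meant to be the gradient flow of \<open>J\<close> starting in \<open>f\<close>; the infimum of the
  empty set is \<open>\<infinity>\<close> in \<^typ>\<open>ereal\<close>.\<close>

definition extinction_time :: "('a::real_inner \<Rightarrow> ereal) \<Rightarrow> 'a \<Rightarrow> (real \<Rightarrow> 'a) \<Rightarrow> ereal" where
  "extinction_time J f u =
     Inf {ereal t | t. t > 0 \<and> u t = orthogonal_projection (null_space J) f}"

end

theory Submission
  imports Defs
begin

text \<open>
  Suppose the flow has reached the mean \<open>g\<close> of \<open>f\<close>, its projection onto the null space, at time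
  \<open>T\<close>, and test the evolution against a fixed direction \<open>q\<close> orthogonal to the null space with
  \<open>J q\<close> finite. Every subgradient \<open>p t\<close> satisfies \<open>p t \<bullet> q \<le> J q\<close>, so the scalar function
  \<open>t \<mapsto> u t \<bullet> q\<close> has right derivative at least \<open>- J q\<close> and cannot drop by more than \<open>T * J q\<close> on
  \<open>[0, T]\<close>. It starts at \<open>f \<bullet> q\<close> and ends at \<open>g \<bullet> q = 0\<close>; hence \<open>f \<bullet> q \<le> T * J q\<close>, which after
  division by \<open>J q\<close> and passage to the supremum is the asserted bound.

  Two ingredients support this argument. A continuous function with nonnegative right
  derivatives is nondecreasing (\<open>nonneg_right_derivative_imp_le\<close>), which
  replaces the fundamental theorem of calculus, as the flow has only one-sided derivatives. And
  \<open>g \<bullet> q = 0\<close> requires \<open>g\<close> really to lie in the null space: the null space is a closed subspace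
  (\<open>subspace_null_space\<close>, \<open>closed_null_space\<close>), so the Hilbert projection theorem
  (\<open>orthogonal_projection_in\<close>) applies.
\<close>

section \<open>Orthogonal projection onto a closed subspace\<close>

text \<open>The parallelogram identity makes a sequence in \<open>S\<close> that minimises the distance to \<open>f\<close>
  a Cauchy sequence: midpoints stay in \<open>S\<close>, so they cannot be much closer to \<open>f\<close> than the
  infimum.\<close>

lemma closest_point_in_closed_subspace:
  fixes f :: "'a::{real_inner, complete_space}"
  assumes "subspace S" and "closed S"
  obtains g where "g \<in> S" and "\<And>s. s \<in> S \<Longrightarrow> norm (f - g) \<le> norm (f - s)"
proof -
  define D where "D = (\<lambda>s. (norm (f - s))\<^sup>2) ` S"
  define d where "d = Inf D"
  have ne: "D \<noteq> {}"
    using subspace_0[OF assms(1)] by (auto simp: D_def)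
  have bdd: "bdd_below D"
    unfolding D_def by (rule bdd_belowI[of _ 0]) auto
  have d_le: "d \<le> (norm (f - s))\<^sup>2" if "s \<in> S" for s
    unfolding d_def by (rule cInf_lower) (use that bdd in \<open>auto simp: D_def\<close>)
  have "\<exists>s\<in>S. (norm (f - s))\<^sup>2 < d + inverse (real (Suc n))" for n
    using cInf_lessD[OF ne, of "d + inverse (real (Suc n))"]
    by (auto simp: D_def d_def)
  then obtain y where yS: "\<And>n. y n \<in> S"
    and yd: "\<And>n. (norm (f - y n))\<^sup>2 < d + inverse (real (Suc n))"
    by metis
  have par: "(norm (a - b))\<^sup>2 \<le> 2 * (norm (f - a))\<^sup>2 + 2 * (norm (f - b))\<^sup>2 - 4 * d"
    if "a \<in> S" "b \<in> S" for a b
  proof -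
    have "(1/2) *\<^sub>R (a + b) \<in> S"
      using assms(1) that by (simp add: subspace_add subspace_scale)
    moreover have "(norm (a - b))\<^sup>2 =
        2 * (norm (f - a))\<^sup>2 + 2 * (norm (f - b))\<^sup>2 - 4 * (norm (f - (1/2) *\<^sub>R (a + b)))\<^sup>2"
      unfolding power2_norm_eq_inner
      by (simp add: algebra_simps inner_commute)
    ultimately show ?thesis
      using d_le by fastforce
  qed
  have "Cauchy y"
  proof (rule CauchyI)
    fix e :: real assume "e > 0"
    then obtain M where M: "inverse (real (Suc M)) < e\<^sup>2 / 4"
      using reals_Archimedean[of "e\<^sup>2 / 4"] by auto
    have "norm (y m - y n) < e" if "m \<ge> M" "n \<ge> M" for m n
    proof -
      have "inverse (real (Suc m)) \<le> inverse (real (Suc M))"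
        and "inverse (real (Suc n)) \<le> inverse (real (Suc M))"
        using that by (auto intro!: le_imp_inverse_le)
      then have "(norm (y m - y n))\<^sup>2 < e\<^sup>2"
        using par[OF yS[of m] yS[of n]] yd[of m] yd[of n] M by linarith
      then show ?thesis
        using \<open>e > 0\<close> power_less_imp_less_base by fastforce
    qed
    then show "\<exists>M. \<forall>m\<ge>M. \<forall>n\<ge>M. norm (y m - y n) < e" by blast
  qed
  then obtain g where g: "y \<longlonglongrightarrow> g"
    using Cauchy_convergent convergent_def by blast
  have gS: "g \<in> S"
    using closed_sequentially[OF assms(2) _ g] yS by blast
  have "(\<lambda>n. (norm (f - y n))\<^sup>2) \<longlonglongrightarrow> (norm (f - g))\<^sup>2"
    by (intro tendsto_intros g)
  moreover have "(\<lambda>n. d + inverse (real (Suc n))) \<longlonglongrightarrow> d + 0"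
    by (intro tendsto_intros LIMSEQ_inverse_real_of_nat)
  ultimately have "(norm (f - g))\<^sup>2 \<le> d + 0"
    by (rule LIMSEQ_le) (intro exI allI impI less_imp_le yd)
  then have "(norm (f - g))\<^sup>2 \<le> (norm (f - s))\<^sup>2" if "s \<in> S" for s
    using d_le[OF that] by linarith
  then have "norm (f - g) \<le> norm (f - s)" if "s \<in> S" for s
    using that by (metis norm_ge_zero power2_le_imp_le)
  with gS show thesis by (rule that)
qed

text \<open>A vector that does not get shorter when elements of a subspace are subtracted is orthogonal
  to it; applied to \<open>f - g\<close> for the closest point \<open>g\<close>, this shows that the description defining
  the projection has a unique solution.\<close>

lemma orthogonal_projection_in:
  fixes f :: "'a::{real_inner, complete_space}"
  assumes S: "subspace S" and "closed S"
  shows "orthogonal_projection S f \<in> S"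
proof -
  obtain g where gS: "g \<in> S" and min: "\<And>s. s \<in> S \<Longrightarrow> norm (f - g) \<le> norm (f - s)"
    using closest_point_in_closed_subspace[OF assms] by blast
  have orth: "s \<bullet> (f - g) = 0" if s: "s \<in> S" for s
  proof (cases "s = 0")
    case False
    \<comment> \<open>the coefficient of the projection of \<open>f - g\<close> onto the line through \<open>s\<close>\<close>
    define c where "c = (s \<bullet> (f - g)) / (s \<bullet> s)"
    have "g + c *\<^sub>R s \<in> S"
      using S gS s by (simp add: subspace_add subspace_scale)
    then have "norm (f - g) \<le> norm (f - g - c *\<^sub>R s)"
      using min by (metis diff_diff_add)
    then have "(f - g) \<bullet> (f - g) \<le> (f - g - c *\<^sub>R s) \<bullet> (f - g - c *\<^sub>R s)"
      by (simp add: norm_le)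
    also have "\<dots> = (f - g) \<bullet> (f - g) - 2 * c * (s \<bullet> (f - g)) + c * (c * (s \<bullet> s))"
      by (simp add: inner_diff_left inner_diff_right inner_commute algebra_simps)
    also have "c * (s \<bullet> s) = s \<bullet> (f - g)"
      using False by (simp add: c_def)
    finally have "c * (s \<bullet> (f - g)) \<le> 0" by simp
    then have "(s \<bullet> (f - g))\<^sup>2 / (s \<bullet> s) \<le> 0"
      by (simp add: c_def power2_eq_square)
    moreover have "0 < s \<bullet> s" using False by simp
    ultimately show ?thesis by (auto simp: divide_le_0_iff)
  qed simp
  have "orthogonal_projection S f = g"
    unfolding orthogonal_projection_def
  proof (rule the_equality)
    show "g \<in> S \<and> f - g \<in> S\<^sup>\<bottom>"
      using gS orth by (auto simp: orthogonal_comp_def orthogonal_def)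
  next
    fix h assume h: "h \<in> S \<and> f - h \<in> S\<^sup>\<bottom>"
    then have hg: "h - g \<in> S" using gS S by (simp add: subspace_diff)
    then have "(h - g) \<bullet> (f - h) = 0" and "(h - g) \<bullet> (f - g) = 0"
      using h orth by (auto simp: orthogonal_comp_def orthogonal_def)
    then have "(h - g) \<bullet> (h - g) = 0"
      by (simp add: inner_diff_right)
    then show "h = g" by simp
  qed
  then show ?thesis using gS by simp
qed

section \<open>The null space of a functional\<close>

text \<open>Convexity at the midpoint of \<open>u\<close> and \<open>- u\<close>, where \<open>J\<close> takes equal values.\<close>

lemma functional_class_nonneg:
  assumes "J \<in> functional_class"
  shows "0 \<le> J u"
proof -
  have conv: "ereal_convex J" and hom: "abs_one_homogeneous J" and "J u \<noteq> -\<infinity>"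
    using assms by (auto simp: functional_class_def)
  have "J ((1 - 1/2) *\<^sub>R u + (1/2) *\<^sub>R (- u)) \<le> ereal (1 - 1/2) * J u + ereal (1/2) * J (- u)"
    by (rule conv[unfolded ereal_convex_def, rule_format]) simp
  moreover have "J (- u) = J u"
    using hom[unfolded abs_one_homogeneous_def, THEN conjunct1, rule_format, of "-1" u]
    by (simp flip: one_ereal_def)
  moreover have "J 0 = 0" using hom by (simp add: abs_one_homogeneous_def)
  ultimately show ?thesis
    using \<open>J u \<noteq> -\<infinity>\<close> by (cases "J u") auto
qed

lemma subspace_null_space:
  assumes "J \<in> functional_class"
  shows "subspace (null_space J)"
proof -
  have conv: "ereal_convex J" and hom: "abs_one_homogeneous J"
    using assms by (auto simp: functional_class_def)
  have zero: "J 0 = 0"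
    and hom': "\<And>u c. c \<noteq> 0 \<Longrightarrow> J (c *\<^sub>R u) = ereal \<bar>c\<bar> * J u"
    using hom by (auto simp: abs_one_homogeneous_def)
  have scale: "J (c *\<^sub>R u) = 0" if "J u = 0" for c u
    using that zero hom'[of c u] by (cases "c = 0") auto
  have add: "J (u + v) = 0" if "J u = 0" "J v = 0" for u v
  proof -
    have "J ((1 - 1/2) *\<^sub>R (2 *\<^sub>R u) + (1/2) *\<^sub>R (2 *\<^sub>R v))
        \<le> ereal (1 - 1/2) * J (2 *\<^sub>R u) + ereal (1/2) * J (2 *\<^sub>R v)"
      by (rule conv[unfolded ereal_convex_def, rule_format]) simp
    then have "J (u + v) \<le> 0" using scale that by simp
    then show ?thesis using functional_class_nonneg[OF assms] by (simp add: antisym)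
  qed
  show ?thesis
    unfolding subspace_def null_space_def using zero scale add by auto
qed

text \<open>The null space is the sublevel set at the minimal value of a lower semicontinuous
  functional.\<close>

lemma closed_null_space:
  assumes "J \<in> functional_class"
  shows "closed (null_space J)"
  unfolding closed_limpt
proof (intro allI impI)
  fix u assume lim: "u islimpt null_space J"
  have "J u \<le> 0"
  proof (rule ccontr)
    assume "\<not> J u \<le> 0"
    moreover have "J u \<le> Liminf (at u) J"
      using assms by (simp add: functional_class_def lower_semicontinuous_def)
    ultimately have "eventually (\<lambda>v. 0 < J v) (at u)"
      by (intro less_LiminfD) auto
    then have "eventually (\<lambda>v. v \<notin> null_space J) (at u)"
      by (rule eventually_mono) (auto simp: null_space_def)
    then show False using lim by (simp add: islimpt_iff_eventually)
  qed
  then show "u \<in> null_space J"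
    using functional_class_nonneg[OF assms, of u] by (simp add: null_space_def antisym)
qed

section \<open>Monotonicity from right derivatives\<close>

text \<open>If \<open>g b < g a\<close>, a small linear perturbation makes the right derivatives strictly positive
  while keeping the drop. Beyond the last point at which the perturbed function is at least an
  intermediate value it would have to stay below that value, although it increases there.\<close>

lemma nonneg_right_derivative_imp_le:
  fixes g D :: "real \<Rightarrow> real"
  assumes "a \<le> b" and cont: "continuous_on {a..b} g"
    and deriv: "\<And>t. a < t \<Longrightarrow> t < b \<Longrightarrow> (g has_real_derivative D t) (at_right t)"
    and nonneg: "\<And>t. a < t \<Longrightarrow> t < b \<Longrightarrow> 0 \<le> D t"
  shows "g a \<le> g b"
proof (rule ccontr)
  assume "\<not> g a \<le> g b"
  with \<open>a \<le> b\<close> have drop: "g b < g a" and "a < b" by (auto simp: order_le_less)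
  define e where "e = (g a - g b) / (2 * (b - a))"
  have e: "e > 0" and eb: "e * (b - a) = (g a - g b) / 2"
    using drop \<open>a < b\<close> by (auto simp: e_def field_simps)
  define h where "h t = g t + e * (t - a)" for t
  have hcont: "continuous_on {a..b} h"
    unfolding h_def by (intro continuous_intros cont)
  have "h b < h a" using eb drop by (simp add: h_def)
  define y where "y = (h a + h b) / 2"
  have y: "h b < y" "y < h a" using \<open>h b < h a\<close> by (auto simp: y_def)
  \<comment> \<open>Starting the maximisation at an interior point \<open>c\<close> keeps the maximiser away from \<open>a\<close>, where
    no derivative is available.\<close>
  obtain c where c: "a \<le> c" "c \<le> b" "h c = y"
    using IVT2'[of h b y a] y hcont \<open>a \<le> b\<close> by auto
  have "a < c" using c y by (auto simp: order_le_less)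
  define A where "A = {c..b} \<inter> h -` {y..}"
  have "closed A"
    unfolding A_def
    by (rule continuous_closed_preimage) (use c in \<open>auto intro: continuous_on_subset[OF hcont]\<close>)
  moreover have "bounded A"
    by (rule bounded_subset[of "{c..b}"]) (auto simp: A_def)
  ultimately have "compact A" by (simp add: compact_eq_bounded_closed)
  moreover have "A \<noteq> {}" using c by (auto simp: A_def)
  ultimately obtain s where s: "s \<in> A" and smax: "\<And>t. t \<in> A \<Longrightarrow> t \<le> s"
    using compact_attains_sup by metis
  have "s \<noteq> b" using s y by (auto simp: A_def)
  with s \<open>a < c\<close> have "a < s" "s < b" by (auto simp: A_def)
  then have "(h has_real_derivative D s + e) (at_right s)"
    unfolding h_def by (auto intro!: derivative_eq_intros deriv)
  moreover have "0 < D s + e" using nonneg[OF \<open>a < s\<close> \<open>s < b\<close>] e by simp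
  ultimately obtain d where d: "d > 0"
      "\<And>k. k > 0 \<Longrightarrow> s + k \<in> {s<..} \<Longrightarrow> k < d \<Longrightarrow> h s < h (s + k)"
    using has_real_derivative_pos_inc_right by blast
  define k where "k = min (d / 2) (b - s)"
  have k: "0 < k" "k < d" "s + k \<le> b" using d(1) \<open>s < b\<close> by (auto simp: k_def)
  then have "h s < h (s + k)" using d(2) by simp
  then have "s + k \<in> A" using s k by (auto simp: A_def)
  then show False using smax k by force
qed

section \<open>The extinction time bound\<close>

text \<open>The loss of \<open>u t \<bullet> q\<close> per unit of time is \<open>p t \<bullet> q\<close>, which a subgradient
  bounds by \<open>J q\<close>.\<close>

lemma gradient_flow_inner_decrease:
  assumes flow: "gradient_flow J f u p" and "0 \<le> T" and Jq: "J q = ereal c"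
  shows "f \<bullet> q - u T \<bullet> q \<le> T * c"
proof -
  have cont: "continuous_on {0..} u" and u0: "u 0 = f"
    and deriv: "\<And>t. t > 0 \<Longrightarrow> (u has_vector_derivative - p t) (at_right t)"
    and sub: "\<And>t. t > 0 \<Longrightarrow> p t \<in> subdifferential J (u t)"
    using flow by (auto simp: gradient_flow_def is_arg_min_def)
  have "u 0 \<bullet> q + c * 0 \<le> u T \<bullet> q + c * T"
  proof (rule nonneg_right_derivative_imp_le
      [where g = "\<lambda>t. u t \<bullet> q + c * t" and D = "\<lambda>t. - (p t \<bullet> q) + c"])
    show "continuous_on {0..T} (\<lambda>t. u t \<bullet> q + c * t)"
      by (intro continuous_intros continuous_on_subset[OF cont]) auto
  next
    fix t :: real assume "0 < t"
    have "((\<lambda>t. u t \<bullet> q) has_vector_derivative (- p t) \<bullet> q) (at_right t)"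
      by (rule bounded_linear.has_vector_derivative[OF bounded_linear_inner_left deriv[OF \<open>0 < t\<close>]])
    then show "((\<lambda>t. u t \<bullet> q + c * t) has_real_derivative - (p t \<bullet> q) + c) (at_right t)"
      unfolding has_real_derivative_iff_has_vector_derivative[symmetric]
      by (auto intro!: derivative_eq_intros)
    have "ereal (p t \<bullet> q) \<le> J q"
      using sub[OF \<open>0 < t\<close>] by (simp add: subdifferential_def)
    then show "0 \<le> - (p t \<bullet> q) + c" by (simp add: Jq)
  qed (use \<open>0 \<le> T\<close> in auto)
  then show ?thesis by (simp add: u0 algebra_simps)
qed

theorem proposition6p9:
  fixes J :: "'a::{real_inner, complete_space} \<Rightarrow> ereal"
    and f :: 'a
    and u p :: "real \<Rightarrow> 'a"
  assumes "J \<in> functional_class"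
    and "f \<in> closure (dom_subdifferential J)"
    and "gradient_flow J f u p"
  shows "extinction_time J f u \<ge> dual_norm J f"
  unfolding extinction_time_def
proof (rule Inf_greatest, clarify)
  fix T :: real
  assume "0 < T" and uT: "u T = orthogonal_projection (null_space J) f"
  have null: "u T \<in> null_space J"
    unfolding uT
    by (intro orthogonal_projection_in subspace_null_space closed_null_space assms)
  show "dual_norm J f \<le> ereal T"
    unfolding dual_norm_def
  proof (rule SUP_least)
    fix q assume q: "q \<in> (null_space J)\<^sup>\<bottom>"
    show "(if q = 0 \<or> J q = \<infinity> then 0 else ereal (f \<bullet> q) / J q) \<le> ereal T"
    proof (cases "q = 0 \<or> J q = \<infinity>")
      case True
      then show ?thesis using \<open>0 < T\<close> by simp
    next
      case False
      \<comment> \<open>A vector with \<open>J q = 0\<close> would be orthogonal to itself.\<close>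
      have "q \<notin> null_space J"
        using q False by (auto simp: orthogonal_comp_def orthogonal_def)
      then have "J q \<noteq> 0" by (simp add: null_space_def)
      then obtain c where c: "J q = ereal c" "0 < c"
        using functional_class_nonneg[OF assms(1), of q] False by (cases "J q") auto
      have "u T \<bullet> q = 0"
        using q null by (auto simp: orthogonal_comp_def orthogonal_def)
      then have "f \<bullet> q \<le> T * c"
        using gradient_flow_inner_decrease[OF assms(3) _ c(1), of T] \<open>0 < T\<close> by simp
      then show ?thesis
        using False c by (simp add: divide_le_eq)
    qed
  qed
qed

end
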